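(* Let $G$ be a connected graph. If $G$ has at least one anti-cycle vertex, then the central graph $C(G)$ satisfies $\gamma_p(C(G))=1$.
   Context: All graphs are finite, simple and undirected. $N[v]$ denotes the closed neighborhood of $v$ and $N[S]=\bigcup_{v\in S}N[v]$. For $U\subseteq V(G)$, the closure $cl(U)$ is the set obtained from $U$ by repeatedly applying, until no more changes are possible, the rule: if a vertex $u$ is in the current set and exactly one neighbor $w$ of $u$ is not in it, then add $w$. A set $S\subseteq V(G)$ is a power dominating set of $G$ if $cl(N[S])=V(G)$, and the power domination number $\gamma_p(G)$ is the minimum cardinality of a power dominating set. The central graph $C(G)$ of a graph $G$ is obtained by subdividing each edge of $G$ exactly once (inserting one new vertex on each edge) and then joining by an edge every pair of distinct vertices of $G$ that are non-adjacent in $G$. An anti-cycle vertex of $G$ is a vertex $v$ such that the induced subgraph $G[V(G)\setminus\{v\}]$ is acyclic (it may be connected or disconnected). *)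

theory Defs
  imports "Graph_Theory.Digraph_Component"
begin

text \<open>
  Finite simple undirected graphs are represented as in the \<^theory>\<open>Graph_Theory.Digraph\<close>
  library, by the locale \<^locale>\<open>graph\<close>: finite digraphs that are symmetric, loop-free and
  without parallel arcs.  An undirected edge between \<open>u\<close> and \<open>v\<close> is the pair of arcs
  from \<open>u\<close> to \<open>v\<close> and back.
\<close>

definition closed_nbhd :: "('a,'b) pre_digraph \<Rightarrow> 'a \<Rightarrow> 'a set" where
  "closed_nbhd G v = insert v {w. v \<rightarrow>\<^bsub>G\<^esub> w}"

definition closed_nbhd_set :: "('a,'b) pre_digraph \<Rightarrow> 'a set \<Rightarrow> 'a set" where
  "closed_nbhd_set G S = (\<Union>v\<in>S. closed_nbhd G v)"

text \<open>
  The second rule does not ask that \<open>w\<close> is still missing; adding a vertex that is already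
  present changes nothing.  Lemma \<open>power_closure_eq_if_exhausted\<close> below confirms that this is the
  result of applying the propagation rule exhaustively, in any order.
\<close>

inductive_set power_closure :: "('a,'b) pre_digraph \<Rightarrow> 'a set \<Rightarrow> 'a set"
  for G :: "('a,'b) pre_digraph" and U :: "'a set" where
  base: "u \<in> U \<Longrightarrow> u \<in> power_closure G U"
| propagate: "\<lbrakk> u \<in> power_closure G U; u \<rightarrow>\<^bsub>G\<^esub> w;
    \<forall>x. u \<rightarrow>\<^bsub>G\<^esub> x \<longrightarrow> x \<noteq> w \<longrightarrow> x \<in> power_closure G U \<rbrakk> \<Longrightarrow> w \<in> power_closure G U"

definition propagation_step :: "('a,'b) pre_digraph \<Rightarrow> 'a set \<Rightarrow> 'a set \<Rightarrow> bool" where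
  "propagation_step G S T \<longleftrightarrow>
    (\<exists>u w. u \<in> S \<and> {x. u \<rightarrow>\<^bsub>G\<^esub> x \<and> x \<notin> S} = {w} \<and> T = insert w S)"

lemma power_closure_eq_if_exhausted:
  assumes reach: "(propagation_step G)\<^sup>*\<^sup>* U T"
    and exhausted: "\<not> (\<exists>T'. propagation_step G T T')"
  shows "power_closure G U = T"
proof
  have "U \<subseteq> T" using reach
    by induction (auto simp: propagation_step_def)
  show "power_closure G U \<subseteq> T"
  proof
    fix y assume "y \<in> power_closure G U"
    then show "y \<in> T"
    proof induction
      case (base u)
      then show ?case using \<open>U \<subseteq> T\<close> by blast
    next
      case (propagate u w)
      show ?case
      proof (rule ccontr)
        assume "w \<notin> T"
        with propagate have "{x. u \<rightarrow>\<^bsub>G\<^esub> x \<and> x \<notin> T} = {w}" by blast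
        with propagate exhausted show False by (auto simp: propagation_step_def)
      qed
    qed
  qed
  show "T \<subseteq> power_closure G U" using reach
  proof induction
    case base
    then show ?case by (auto intro: power_closure.base)
  next
    case (step S T)
    then obtain u w where uw: "u \<in> S" "{x. u \<rightarrow>\<^bsub>G\<^esub> x \<and> x \<notin> S} = {w}" "T = insert w S"
      by (auto simp: propagation_step_def)
    have "w \<in> power_closure G U"
      by (rule power_closure.propagate[of u]) (use uw step.IH in blast)+
    with uw step.IH show ?case by blast
  qed
qed

definition power_dominating_set :: "('a,'b) pre_digraph \<Rightarrow> 'a set \<Rightarrow> bool" where
  "power_dominating_set G S \<longleftrightarrow>
    S \<subseteq> verts G \<and> power_closure G (closed_nbhd_set G S) = verts G"

definition power_domination_number :: "('a,'b) pre_digraph \<Rightarrow> nat" where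
  "power_domination_number G = (LEAST k. \<exists>S. power_dominating_set G S \<and> card S = k)"

text \<open>
  A vertex \<open>Inl v\<close> of the central graph is the original vertex \<open>v\<close>, and \<open>Inr {u, v}\<close> is the
  vertex inserted on the edge between \<open>u\<close> and \<open>v\<close>.
\<close>

definition edge_sets :: "('a,'b) pre_digraph \<Rightarrow> 'a set set" where
  "edge_sets G = {{u, v} | u v. u \<rightarrow>\<^bsub>G\<^esub> v}"

definition central_graph :: "('a,'b) pre_digraph \<Rightarrow> ('a + 'a set) pair_pre_digraph" where
  "central_graph G =
    \<lparr> pverts = Inl ` verts G \<union> Inr ` edge_sets G,
      parcs = {(Inl u, Inr e) | u e. e \<in> edge_sets G \<and> u \<in> e}
        \<union> {(Inr e, Inl u) | u e. e \<in> edge_sets G \<and> u \<in> e}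
        \<union> {(Inl u, Inl v) | u v. u \<in> verts G \<and> v \<in> verts G \<and> u \<noteq> v \<and> \<not> u \<rightarrow>\<^bsub>G\<^esub> v} \<rparr>"

lemma pair_graph_central_graph:
  assumes "graph G"
  shows "pair_graph (central_graph G)"
proof -
  interpret graph G by fact
  have edges: "edge_sets G \<subseteq> Pow (verts G)"
    by (auto simp: edge_sets_def dest: adj_in_verts)
  then have "finite (edge_sets G)"
    by (rule finite_subset) simp
  then have verts: "finite (pverts (central_graph G))"
    by (simp add: central_graph_def)
  have wf: "parcs (central_graph G) \<subseteq> pverts (central_graph G) \<times> pverts (central_graph G)"
    using edges by (auto simp: central_graph_def)
  have fin: "finite (parcs (central_graph G))"
    by (rule finite_subset[OF wf]) (simp add: verts)
  have sym: "sym (parcs (central_graph G))"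
    by (rule symI) (auto simp: central_graph_def dest: graph_symmetric)
  show ?thesis
  proof
    fix e assume "e \<in> parcs (central_graph G)"
    then show "fst e \<noteq> snd e" by (auto simp: central_graph_def)
  qed (use wf verts fin sym in \<open>auto simp: symmetric_def\<close>)
qed

text \<open>
  In a symmetric digraph \<^const>\<open>pre_digraph.cycle\<close> also holds of \<open>u, v, u\<close>, that is, of
  traversing a single undirected edge back and forth.  The undirected cycles are those of
  length at least 3, so the library's \<^const>\<open>forest\<close> cannot be used here.
\<close>

definition acyclic_graph :: "('a,'b) pre_digraph \<Rightarrow> bool" where
  "acyclic_graph G \<longleftrightarrow> \<not> (\<exists>p. pre_digraph.cycle G p \<and> length p \<ge> 3)"

definition anti_cycle_vertex :: "('a,'b) pre_digraph \<Rightarrow> 'a \<Rightarrow> bool" where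
  "anti_cycle_vertex G v \<longleftrightarrow> v \<in> verts G \<and> acyclic_graph (G \<restriction> (verts G - {v}))"

end

theory Submission
  imports Defs
begin

text \<open>
  An anti-cycle vertex \<open>v\<close> alone power dominates the central graph. Its closed neighborhood
  contains the non-neighbors of \<open>v\<close> in \<open>G\<close> and the subdivision vertices of all edges at \<open>v\<close>. Such
  a subdivision vertex has only two neighbors, \<open>v\<close> and the other end of its edge, so it forces
  that end; hence every original vertex is reached. From then on an original vertex \<open>x\<close> can only
  lack subdivision vertices of edges at \<open>x\<close>, and it forces the last missing one. The edges of \<open>G\<close>
  whose subdivision vertex is never reached avoid \<open>v\<close> and so form a forest. If there were any,
  the forest would have a leaf (lemma \<open>acyclic_graph_has_leaf\<close>), and that leaf would force the
  subdivision vertex of its only unreached edge.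

  No smaller set works, because nothing is ever reached from the empty set.
\<close>

text \<open>
  Take a path of maximal length. Its first vertex \<open>x\<close> has a neighbor other than the second
  vertex of the path, and by maximality that neighbor lies on the path. The part of the path up
  to it closes up to a cycle; avoiding the second vertex makes this cycle have length at least 3.
\<close>

lemma sym_relation_without_leaf_has_cycle:
  assumes fin: "finite (Field E)" and "sym E" and "irrefl E" and "E \<noteq> {}"
    and noleaf: "\<And>x y. (x, y) \<in> E \<Longrightarrow> \<exists>z. (x, z) \<in> E \<and> z \<noteq> y"
  shows "\<exists>xs. distinct xs \<and> length xs \<ge> 3 \<and> successively (\<lambda>x y. (x, y) \<in> E) xs
    \<and> (last xs, hd xs) \<in> E \<and> set xs \<subseteq> Field E"
proof -
  define path where "path xs \<longleftrightarrow> distinct xs \<and> set xs \<subseteq> Field E \<and> length xs \<ge> 2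
    \<and> successively (\<lambda>x y. (x, y) \<in> E) xs" for xs
  obtain a b where ab: "(a, b) \<in> E"
    using \<open>E \<noteq> {}\<close> by auto
  with \<open>irrefl E\<close> have "path [a, b]"
    by (auto simp: path_def irrefl_def intro: FieldI1 FieldI2)
  moreover have "length xs < Suc (card (Field E))" if "path xs" for xs
    using that card_mono[OF fin, of "set xs"] by (auto simp: path_def distinct_card)
  ultimately obtain xs where xs: "path xs" and max: "\<And>ys. path ys \<Longrightarrow> length ys \<le> length xs"
    using ex_has_greatest_nat[of path "[a, b]" length "Suc (card (Field E))"] by auto
  then obtain x y zs where xs_eq: "xs = x # y # zs"
    by (cases xs; cases "tl xs") (auto simp: path_def)
  with xs have "(x, y) \<in> E"
    by (simp add: path_def)
  then obtain z where z: "(x, z) \<in> E" "z \<noteq> y"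
    using noleaf by blast
  then have zx: "(z, x) \<in> E" "z \<noteq> x"
    using \<open>sym E\<close> \<open>irrefl E\<close> by (auto simp: sym_def irrefl_def)
  have "z \<in> set xs"
  proof (rule ccontr)
    assume "z \<notin> set xs"
    with xs zx have "path (z # xs)"
      by (auto simp: path_def xs_eq intro: FieldI1)
    then show False
      using max[of "z # xs"] by simp
  qed
  with z zx have "z \<in> set zs"
    by (simp add: xs_eq)
  then obtain as bs where "zs = as @ z # bs"
    by (meson split_list)
  then have "xs = (x # y # as @ [z]) @ bs"
    by (simp add: xs_eq)
  with xs have "distinct (x # y # as @ [z])"
    and "successively (\<lambda>x y. (x, y) \<in> E) (x # y # as @ [z])"
    and "set (x # y # as @ [z]) \<subseteq> Field E"
    unfolding path_def
    by (metis distinct_append, metis successively_append_iff, metis le_sup_iff set_append)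
  with zx show ?thesis
    by (intro exI[of _ "x # y # as @ [z]"]) auto
qed

lemma (in wf_digraph) awalk_of_vertex_list:
  assumes "successively (\<lambda>x y. x \<rightarrow>\<^bsub>G\<^esub> y) xs" and "set xs \<subseteq> verts G" and "xs \<noteq> []"
  shows "\<exists>p. awalk (hd xs) p (last xs) \<and> awalk_verts (hd xs) p = xs"
  using assms
proof (induction xs rule: induct_list012)
  case (2 x)
  then show ?case
    by (intro exI[of _ "[]"]) (simp add: awalk_Nil_iff)
next
  case (3 x y zs)
  then obtain p where p: "awalk y p (last (y # zs))" "awalk_verts y p = y # zs"
    by auto
  from 3 obtain a where "a \<in> arcs G" "tail G a = x" "head G a = y"
    by (auto simp: arcs_ends_conv)
  with p show ?case
    by (intro exI[of _ "a # p"]) (auto simp: awalk_Cons_iff)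
qed simp

text \<open>
  Without a leaf, \<open>E\<close> would contain a cyclic vertex sequence of length at least 3, and walking
  along its edges gives a cycle of \<open>H\<close>. A subset \<open>E\<close> of the edges is allowed because the lemma is
  meant for the edges that are still unreached; the leaf then has just one of these, although it
  may have many neighbors in \<open>H\<close>.
\<close>

lemma acyclic_graph_has_leaf:
  assumes "graph H" and acyclic: "acyclic_graph H"
    and E: "E \<subseteq> arcs_ends H" "sym E" "E \<noteq> {}"
  shows "\<exists>x y. (x, y) \<in> E \<and> (\<forall>z. (x, z) \<in> E \<longrightarrow> z = y)"
proof (rule ccontr)
  assume noleaf: "\<not> ?thesis"
  interpret H: graph H by fact
  have verts: "Field E \<subseteq> verts H"
    using E(1) by (auto simp: Field_def dest: H.adj_in_verts)
  have "irrefl E"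
    using E(1) by (auto simp: irrefl_def dest: H.adj_not_same)
  with verts noleaf E obtain xs where xs: "distinct xs" "length xs \<ge> 3"
      "successively (\<lambda>x y. (x, y) \<in> E) xs" "(last xs, hd xs) \<in> E" "set xs \<subseteq> Field E"
    using sym_relation_without_leaf_has_cycle[of E] finite_subset[OF verts] by auto
  \<comment> \<open>The closed walk starts at the last vertex, so that the tail of its vertex list is the distinct
    list \<open>xs\<close>, as the definition of a cycle asks.\<close>
  define ys where "ys = last xs # xs"
  have "xs \<noteq> []"
    using xs(2) by auto
  then have "successively (\<lambda>x y. (x, y) \<in> E) ys"
    using xs by (cases xs) (auto simp: ys_def)
  then have "successively (\<lambda>x y. x \<rightarrow>\<^bsub>H\<^esub> y) ys"
    by (rule successively_mono) (use E(1) in auto)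
  moreover have "set ys \<subseteq> verts H"
    using verts xs(5) last_in_set[OF \<open>xs \<noteq> []\<close>] by (auto simp: ys_def)
  ultimately obtain p where p: "H.awalk (last xs) p (last xs)" "H.awalk_verts (last xs) p = ys"
    using H.awalk_of_vertex_list[of ys] \<open>xs \<noteq> []\<close> by (auto simp: ys_def)
  have len: "length p = length xs"
    using H.length_awalk_verts[of "last xs" p] p(2) by (simp add: ys_def)
  then have "H.cycle p"
    using p xs \<open>xs \<noteq> []\<close> by (auto simp: H.cycle_def ys_def)
  with len xs(2) acyclic show False
    by (auto simp: acyclic_graph_def)
qed

lemma (in graph) graph_induce_subgraph:
  assumes "S \<subseteq> verts G"
  shows "graph (G \<restriction> S)"
proof -
  have "induced_subgraph (G \<restriction> S) G"
    using assms by (rule induced_induce)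
  then have "digraph (G \<restriction> S)" "sym_digraph (G \<restriction> S)"
    by (auto intro: digraphI_induced induced_graph_imp_graph)
  then show ?thesis
    by (simp add: graph_def pseudo_graph_def digraph.axioms(1))
qed

lemma power_closure_subset_verts:
  assumes "wf_digraph G" and "U \<subseteq> verts G"
  shows "power_closure G U \<subseteq> verts G"
proof
  fix y assume "y \<in> power_closure G U"
  then show "y \<in> verts G"
    by induction (use assms in \<open>auto intro: wf_digraph.adj_in_verts\<close>)
qed

lemma power_closure_empty: "power_closure G {} = {}"
proof -
  have False if "y \<in> power_closure G {}" for y
    using that by induction auto
  then show ?thesis
    by blast
qed

lemma arcs_ends_central_graph:
  "Inl x \<rightarrow>\<^bsub>with_proj (central_graph G)\<^esub> Inr e \<longleftrightarrow> e \<in> edge_sets G \<and> x \<in> e"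
  "Inr e \<rightarrow>\<^bsub>with_proj (central_graph G)\<^esub> Inl x \<longleftrightarrow> e \<in> edge_sets G \<and> x \<in> e"
  "Inl x \<rightarrow>\<^bsub>with_proj (central_graph G)\<^esub> Inl y \<longleftrightarrow>
    x \<in> verts G \<and> y \<in> verts G \<and> x \<noteq> y \<and> \<not> x \<rightarrow>\<^bsub>G\<^esub> y"
  "\<not> Inr e \<rightarrow>\<^bsub>with_proj (central_graph G)\<^esub> Inr f"
  by (auto simp: central_graph_def)

lemma anti_cycle_vertex_power_dominates:
  assumes "graph G" and v: "anti_cycle_vertex G v"
  shows "power_dominating_set (with_proj (central_graph G)) {Inl v}"
proof -
  interpret graph G by fact
  define C where "C = with_proj (central_graph G)"
  note arcs_C = arcs_ends_central_graph[of _ _ G, folded C_def]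
  have verts_C: "verts C = Inl ` verts G \<union> Inr ` edge_sets G"
    by (simp add: C_def central_graph_def)
  interpret C: pair_graph "central_graph G"
    by (rule pair_graph_central_graph) fact
  have "wf_digraph C"
    unfolding C_def by (rule C.wf_digraph)
  have "v \<in> verts G"
    using v by (simp add: anti_cycle_vertex_def)
  define P where "P = power_closure C (closed_nbhd_set C {Inl v})"
  have nbhd: "closed_nbhd_set C {Inl v} = insert (Inl v) {x. Inl v \<rightarrow>\<^bsub>C\<^esub> x}"
    by (simp add: closed_nbhd_set_def closed_nbhd_def)
  then have "closed_nbhd_set C {Inl v} \<subseteq> verts C"
    using \<open>v \<in> verts G\<close> \<open>wf_digraph C\<close> by (auto simp: verts_C dest: wf_digraph.adj_in_verts)
  then have "P \<subseteq> verts C"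
    unfolding P_def by (rule power_closure_subset_verts[OF \<open>wf_digraph C\<close>])
  have propagate: "w \<in> P"
    if "u \<in> P" "u \<rightarrow>\<^bsub>C\<^esub> w" "\<And>x. u \<rightarrow>\<^bsub>C\<^esub> x \<Longrightarrow> x \<noteq> w \<Longrightarrow> x \<in> P" for u w
    using that unfolding P_def by (blast intro: power_closure.propagate)
  have nbhd_P: "x \<in> P" if "x = Inl v \<or> Inl v \<rightarrow>\<^bsub>C\<^esub> x" for x
    using that unfolding P_def nbhd by (auto intro: power_closure.base)
  have edge_at_v: "Inr {v, x} \<in> P" if "v \<rightarrow>\<^bsub>G\<^esub> x" for x
    using that by (intro nbhd_P) (auto simp: arcs_C edge_sets_def)
  have orig: "Inl x \<in> P" if "x \<in> verts G" for x
  proof (cases "v \<rightarrow>\<^bsub>G\<^esub> x")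
    case True
    show ?thesis
    proof (rule propagate)
      show "Inr {v, x} \<in> P"
        using True by (rule edge_at_v)
      show "Inr {v, x} \<rightarrow>\<^bsub>C\<^esub> Inl x"
        using True by (auto simp: arcs_C edge_sets_def)
    next
      fix y assume "Inr {v, x} \<rightarrow>\<^bsub>C\<^esub> y" "y \<noteq> Inl x"
      then have "y = Inl v"
        by (cases y) (auto simp: arcs_C)
      then show "y \<in> P"
        using nbhd_P by simp
    qed
  next
    case False
    then show ?thesis
      using that \<open>v \<in> verts G\<close> nbhd_P by (cases "x = v") (auto simp: arcs_C)
  qed
  \<comment> \<open>All original vertices are reached; what may be missing are subdivision vertices.\<close>
  define E where "E = {(x, y). x \<rightarrow>\<^bsub>G\<^esub> y \<and> Inr {x, y} \<notin> P}"
  have "E = {}"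
  proof (rule ccontr)
    assume "E \<noteq> {}"
    have "sym E"
      by (auto simp: E_def sym_def insert_commute dest: graph_symmetric)
    have "x \<noteq> v \<and> y \<noteq> v" if "(x, y) \<in> E" for x y
      using that edge_at_v[of x] edge_at_v[of y]
      by (auto simp: E_def insert_commute dest: graph_symmetric)
    then have E_sub: "E \<subseteq> arcs_ends (G \<restriction> (verts G - {v}))"
      by (fastforce simp: E_def arcs_ends_conv)
    have "graph (G \<restriction> (verts G - {v}))"
      by (rule graph_induce_subgraph) auto
    with v E_sub \<open>sym E\<close> \<open>E \<noteq> {}\<close> obtain x y
      where xy: "(x, y) \<in> E" and leaf: "\<And>z. (x, z) \<in> E \<Longrightarrow> z = y"
      using acyclic_graph_has_leaf[of "G \<restriction> (verts G - {v})" E]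
      by (auto simp: anti_cycle_vertex_def)
    have "Inr {x, y} \<in> P"
    proof (rule propagate)
      have "x \<in> verts G"
        using xy by (auto simp: E_def dest: adj_in_verts)
      then show "Inl x \<in> P"
        by (rule orig)
      show "Inl x \<rightarrow>\<^bsub>C\<^esub> Inr {x, y}"
        using xy by (auto simp: arcs_C edge_sets_def E_def)
    next
      fix c assume c: "Inl x \<rightarrow>\<^bsub>C\<^esub> c" "c \<noteq> Inr {x, y}"
      show "c \<in> P"
      proof (cases c)
        case (Inl z)
        with c show ?thesis
          using orig by (simp add: arcs_C)
      next
        case (Inr e)
        with c obtain z where "x \<rightarrow>\<^bsub>G\<^esub> z" "e = {x, z}"
          by (auto simp: arcs_C edge_sets_def insert_commute dest: graph_symmetric)
        with c Inr leaf[of z] show ?thesis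
          by (auto simp: E_def)
      qed
    qed
    with xy show False
      by (simp add: E_def)
  qed
  then have "verts C \<subseteq> P"
    using orig by (auto simp: verts_C edge_sets_def E_def)
  with \<open>P \<subseteq> verts C\<close> \<open>v \<in> verts G\<close> show ?thesis
    by (auto simp: power_dominating_set_def verts_C simp flip: C_def P_def)
qed

theorem theorem35:
  fixes G :: "('a, 'b) pre_digraph"
  assumes "graph G"
    and "Digraph_Component.connected G"
    and "\<exists>v. anti_cycle_vertex G v"
  shows "power_domination_number (with_proj (central_graph G)) = 1"
proof -
  interpret graph G by fact
  obtain v where v: "anti_cycle_vertex G v"
    using assms(3) by blast
  interpret C: pair_graph "central_graph G"
    by (rule pair_graph_central_graph) fact
  let ?P = "power_dominating_set (with_proj (central_graph G))"
  have "?P {Inl v}"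
    using anti_cycle_vertex_power_dominates[OF assms(1) v] .
  moreover have "card S \<noteq> 0" if "?P S" for S
  proof
    assume "card S = 0"
    have "finite (verts (with_proj (central_graph G)))"
      using C.pair_finite_verts by simp
    with that \<open>card S = 0\<close> have "S = {}"
      by (auto simp: power_dominating_set_def dest: finite_subset)
    with that have "verts (with_proj (central_graph G)) = {}"
      by (simp add: power_dominating_set_def closed_nbhd_set_def power_closure_empty)
    with v show False
      by (auto simp: anti_cycle_vertex_def central_graph_def)
  qed
  ultimately show ?thesis
    unfolding power_domination_number_def
    by (intro Least_equality exI[of _ "{Inl v}"]) (auto simp: Suc_le_eq)
qed

end
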